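(* Let $n\ge 2$, let $\delta=\sum_{i=1}^n\varepsilon_i\,dx_i\otimes dx_i$ with $\varepsilon_i=\pm1$ be a pseudo-Euclidean metric on $\mathbb{R}^n$, let $\alpha=(\alpha_1,\dots,\alpha_n)$ be a nonzero vector, and let $\xi(x)=\alpha_1x_1+\dots+\alpha_nx_n$. Let $\varphi,f:(a,b)\subset\mathbb{R}\to\mathbb{R}$ be smooth with $\varphi>0$, and suppose that $\xi^{-1}(a,b)\subset\mathbb{R}^n$ with the metric $g=\delta/(\varphi\circ\xi)^2$ is a gradient $k$-Yamabe soliton with potential function $f\circ\xi$. If $\alpha=\sum_{i=1}^n\alpha_i\frac{\partial}{\partial x_i}$ is a light-like vector, i.e. $\|\alpha\|^2=\sum_i\varepsilon_i\alpha_i^2=0$, then the gradient $k$-Yamabe soliton is steady. Moreover, given the conformal function $\varphi$, the potential function is given by $$f(\xi)=\int\frac{c}{\varphi^2(\xi)}\,d\xi+d,\qquad c,d\in\mathbb{R}.$$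
   Context: A pseudo-Riemannian manifold $(M^n,g)$ is a gradient $k$-Yamabe soliton ($1\le k\le n$) if there are a constant $\lambda\in\mathbb{R}$ (the soliton constant) and a function $f\in C^\infty(M)$ (the potential function) with $\nabla^2 f=2(n-1)(\sigma_k-\lambda)g$, where $\nabla^2 f$ is the Hessian of $f$ with respect to $g$ and $\sigma_k$ is the $k$-th elementary symmetric function of the eigenvalues of $g^{-1}A_g$. Here $A_g=\frac1{n-2}\left[Ric_g-\frac{scal_g}{2(n-1)}g\right]$ is the Schouten tensor; for a conformal metric $g=\delta/\varphi^2$ it is computed as $A_g=\frac{\nabla^2_\delta\varphi}{\varphi}-\frac{|\nabla_\delta\varphi|^2}{2\varphi^2}\delta$. The soliton is steady if $\lambda=0$. *)

theory Defs
  imports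
    "HOL-Analysis.Analysis"
    "HOL-Computational_Algebra.Polynomial"
begin

section \<open>Smooth functions on open sets\<close>

definition pderiv_dir :: "'a \<Rightarrow> ('a::euclidean_space \<Rightarrow> real) \<Rightarrow> 'a \<Rightarrow> real" where
  "pderiv_dir v h x = frechet_derivative h (at x) v"

text \<open>On an open set, a function is of class \<open>C\<^sup>\<infinity>\<close> iff all its iterated partial derivatives
  (the order zero one included) exist and are differentiable there.\<close>

definition smooth_on :: "'a::euclidean_space set \<Rightarrow> ('a \<Rightarrow> real) \<Rightarrow> bool" where
  "smooth_on U h \<longleftrightarrow> open U \<and>
     (\<forall>vs. set vs \<subseteq> Basis \<longrightarrow> fold pderiv_dir vs h differentiable_on U)"

abbreviation partial :: "'n \<Rightarrow> (real ^ 'n \<Rightarrow> real) \<Rightarrow> real ^ 'n::finite \<Rightarrow> real" where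
  "partial i \<equiv> pderiv_dir (axis i 1)"

section \<open>Pseudo-Riemannian metrics in coordinates\<close>

text \<open>A metric on an open subset of \<open>\<real>\<^sup>n\<close> is the field of its Gram matrices with respect to the
  coordinate frame; all other tensors of rank two are written as matrix fields in the same way.\<close>

type_synonym 'n matfield = "real ^ 'n \<Rightarrow> real ^ 'n ^ 'n"

definition pseudo_riemannian_metric :: "(real ^ 'n) set \<Rightarrow> 'n::finite matfield \<Rightarrow> bool" where
  "pseudo_riemannian_metric U g \<longleftrightarrow> open U \<and>
     (\<forall>i j. smooth_on U (\<lambda>x. g x $ i $ j)) \<and>
     (\<forall>x\<in>U. transpose (g x) = g x \<and> det (g x) \<noteq> 0)"

text \<open>\<open>christoffel g x m i j\<close> is \<open>\<Gamma>\<^sup>m\<^sub>i\<^sub>j\<close>, for the Levi-Civita connection of \<open>g\<close>.\<close>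

definition christoffel :: "'n::finite matfield \<Rightarrow> real ^ 'n \<Rightarrow> 'n \<Rightarrow> 'n \<Rightarrow> 'n \<Rightarrow> real" where
  "christoffel g x m i j = (1/2) * (\<Sum>l\<in>UNIV. matrix_inv (g x) $ m $ l *
     (partial i (\<lambda>y. g y $ j $ l) x + partial j (\<lambda>y. g y $ i $ l) x
        - partial l (\<lambda>y. g y $ i $ j) x))"

definition hessian :: "'n::finite matfield \<Rightarrow> (real ^ 'n \<Rightarrow> real) \<Rightarrow> 'n matfield" where
  "hessian g h x = (\<chi> i j. partial i (partial j h) x
     - (\<Sum>m\<in>UNIV. christoffel g x m i j * partial m h x))"

text \<open>The squared norm \<open>|\<nabla>h|\<^sup>2\<close> of the gradient, which may be negative for indefinite \<open>g\<close>.\<close>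

definition grad_norm_sq :: "'n::finite matfield \<Rightarrow> (real ^ 'n \<Rightarrow> real) \<Rightarrow> real ^ 'n \<Rightarrow> real" where
  "grad_norm_sq g h x =
     (\<Sum>i\<in>UNIV. \<Sum>j\<in>UNIV. matrix_inv (g x) $ i $ j * partial i h x * partial j h x)"

text \<open>Sign convention: the round sphere has positive Ricci curvature.\<close>

definition ricci :: "'n::finite matfield \<Rightarrow> 'n matfield" where
  "ricci g x = (\<chi> i j.
     (\<Sum>m\<in>UNIV. partial m (\<lambda>y. christoffel g y m i j) x
               - partial j (\<lambda>y. christoffel g y m i m) x)
   + (\<Sum>m\<in>UNIV. \<Sum>l\<in>UNIV. christoffel g x m m l * christoffel g x l i j
                        - christoffel g x m j l * christoffel g x l i m))"

definition scal :: "'n::finite matfield \<Rightarrow> real ^ 'n \<Rightarrow> real" where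
  "scal g x = (\<Sum>i\<in>UNIV. \<Sum>j\<in>UNIV. matrix_inv (g x) $ i $ j * ricci g x $ i $ j)"

section \<open>Pseudo-Euclidean and conformally pseudo-Euclidean metrics\<close>

definition pseudo_euclidean :: "('n \<Rightarrow> real) \<Rightarrow> 'n::finite matfield" where
  "pseudo_euclidean \<epsilon> x = (\<chi> i j. if i = j then \<epsilon> i else 0)"

definition conformal_metric :: "('n \<Rightarrow> real) \<Rightarrow> (real ^ 'n \<Rightarrow> real) \<Rightarrow> 'n::finite matfield" where
  "conformal_metric \<epsilon> \<phi> x = (1 / (\<phi> x)\<^sup>2) *\<^sub>R pseudo_euclidean \<epsilon> x"

definition conformal_schouten :: "('n \<Rightarrow> real) \<Rightarrow> (real ^ 'n \<Rightarrow> real) \<Rightarrow> 'n::finite matfield" where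
  "conformal_schouten \<epsilon> \<phi> x =
     (1 / \<phi> x) *\<^sub>R hessian (pseudo_euclidean \<epsilon>) \<phi> x
   - (grad_norm_sq (pseudo_euclidean \<epsilon>) \<phi> x / (2 * (\<phi> x)\<^sup>2)) *\<^sub>R pseudo_euclidean \<epsilon> x"

section \<open>The Schouten tensor\<close>

text \<open>In dimension two the factor \<open>1 / (n - 2)\<close> is meaningless and the Schouten tensor is given by
  the conformal formula instead, for metrics of the form \<open>\<delta> / \<phi>\<^sup>2\<close> (such a presentation is
  unique: \<open>g\<close> determines \<open>\<epsilon>\<close> and \<open>\<phi> > 0\<close>). In dimension at least three the conformal formula
  is a consequence of the definition by the Ricci tensor.\<close>

definition schouten_tensor_on ::
  "(real ^ 'n) set \<Rightarrow> 'n::finite matfield \<Rightarrow> 'n matfield \<Rightarrow> bool" where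
  "schouten_tensor_on U g A \<longleftrightarrow>
     (if CARD('n) = 2
      then \<exists>\<epsilon> \<phi>. (\<forall>i. \<epsilon> i = 1 \<or> \<epsilon> i = -1) \<and> smooth_on U \<phi> \<and> (\<forall>x\<in>U. \<phi> x > 0) \<and>
             (\<forall>x\<in>U. g x = conformal_metric \<epsilon> \<phi> x) \<and> (\<forall>x\<in>U. A x = conformal_schouten \<epsilon> \<phi> x)
      else \<forall>x\<in>U. A x = (1 / (real CARD('n) - 2)) *\<^sub>R
             (ricci g x - (scal g x / (2 * (real CARD('n) - 1))) *\<^sub>R g x))"

section \<open>Elementary symmetric functions of eigenvalues\<close>

text \<open>The index set \<open>{(z, i). i < count M z}\<close> lists the elements of \<open>M\<close> with multiplicity.\<close>

definition elem_sym :: "nat \<Rightarrow> 'a::comm_ring_1 multiset \<Rightarrow> 'a" where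
  "elem_sym k M = (\<Sum>S | S \<subseteq> {(z, i). i < count M z} \<and> card S = k. \<Prod>p\<in>S. fst p)"

text \<open>For indefinite \<open>g\<close> the endomorphism \<open>g\<^sup>-\<^sup>1A\<close> need not be diagonalisable over the reals, so
  eigenvalues are complex roots of the characteristic polynomial with algebraic multiplicity.\<close>

definition eigenvalue_mset :: "real ^ 'n ^ 'n::finite \<Rightarrow> complex multiset" where
  "eigenvalue_mset M =
     proots (det (mat [:0, 1:] - (\<chi> i j. [:complex_of_real (M $ i $ j):])))"

definition sigma :: "nat \<Rightarrow> 'n::finite matfield \<Rightarrow> 'n matfield \<Rightarrow> real ^ 'n \<Rightarrow> complex" where
  "sigma k g A x = elem_sym k (eigenvalue_mset (matrix_inv (g x) ** A x))"

section \<open>Gradient k-Yamabe solitons\<close>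

text \<open>The equation \<open>\<nabla>\<^sup>2 f = 2 (n - 1) (\<sigma>\<^sub>k - c) g\<close>, with soliton constant \<open>c\<close>, is stated
  componentwise in the complex numbers since \<open>\<sigma>\<^sub>k\<close> has that type.\<close>

definition gradient_k_yamabe_soliton ::
  "nat \<Rightarrow> (real ^ 'n) set \<Rightarrow> 'n::finite matfield \<Rightarrow> (real ^ 'n \<Rightarrow> real) \<Rightarrow> real \<Rightarrow> bool" where
  "gradient_k_yamabe_soliton k U g f c \<longleftrightarrow>
     1 \<le> k \<and> k \<le> CARD('n) \<and> pseudo_riemannian_metric U g \<and> smooth_on U f \<and>
     (\<exists>A. schouten_tensor_on U g A \<and>
        (\<forall>x\<in>U. \<forall>i j. complex_of_real (hessian g f x $ i $ j) =
           2 * (of_nat CARD('n) - 1) * (sigma k g A x - complex_of_real c)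
             * complex_of_real (g x $ i $ j)))"

end

theory Submission
  imports Defs
begin

text \<open>Every tensor in the soliton equation has a simple shape because \<open>\<phi>\<close> and \<open>f\<close> depend on the
  single linear function \<open>\<xi> = \<alpha> \<bullet> x\<close> and \<open>\<alpha>\<close> is null. The Hessian and the Schouten tensor of
  \<open>g = \<delta> / \<phi>\<^sup>2\<close> are in general a combination of \<open>\<alpha> \<otimes> \<alpha>\<close> and \<open>\<delta>\<close>, but each coefficient of \<open>\<delta>\<close>
  carries the factor \<open>\<Sum> \<epsilon>\<^sub>i \<alpha>\<^sub>i\<^sup>2 = 0\<close>. What remains is
  \<open>\<nabla>\<^sup>2 f = (f'' + 2 \<phi>' f' / \<phi>) \<alpha> \<otimes> \<alpha>\<close> (lemma \<open>hessian_g\<close>) and \<open>A = (\<phi>'' / \<phi>) \<alpha> \<otimes> \<alpha>\<close>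
  (lemma \<open>schouten_g\<close>).

  Raising an index of \<open>A\<close> gives an endomorphism of square zero, again because \<open>\<alpha>\<close> is null, so all
  its eigenvalues vanish and with them \<open>\<sigma>\<^sub>k\<close> for \<open>k \<ge> 1\<close> (lemma \<open>sigma_g\<close>). The soliton equation
  thus equates a multiple of \<open>\<alpha> \<otimes> \<alpha>\<close> with \<open>-2 (n - 1) c\<^sub>s g\<close>. A nonzero null vector has two
  nonzero components, and the corresponding off-diagonal entry of the diagonal matrix \<open>g\<close> vanishes;
  hence \<open>f'' + 2 \<phi>' f' / \<phi> = 0\<close>. A diagonal entry then gives \<open>c\<^sub>s = 0\<close>. Finally the
  differential equation says that \<open>\<phi>\<^sup>2 f'\<close> is constant, and integrating yields \<open>f\<close>.\<close>

section \<open>Eigenvalues and null vectors\<close>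

lemma eigenvalue_mset_root:
  fixes M :: "real ^ 'n ^ 'n::finite"
  assumes "z \<in># eigenvalue_mset M"
  shows "det (mat z - (\<chi> i j. complex_of_real (M $ i $ j))) = 0"
proof -
  define P where "P = (mat [:0, 1:] - (\<chi> i j. [:complex_of_real (M $ i $ j):]) :: complex poly ^ 'n ^ 'n)"
  have "poly (det P) z = 0"
  proof (cases "det P = 0")
    case False
    with assms show ?thesis
      by (simp add: eigenvalue_mset_def P_def)
  qed simp
  moreover have "poly (P $ i $ j) z = (mat z - (\<chi> i j. complex_of_real (M $ i $ j))) $ i $ j" for i j
    by (simp add: P_def mat_def)
  ultimately show ?thesis
    by (simp add: det_def poly_sum poly_prod)
qed

text \<open>If \<open>M\<^sup>2 = 0\<close> then \<open>(z - M) (z + M) = z\<^sup>2\<close>, so for \<open>z \<noteq> 0\<close> the determinant of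
  \<open>z - M\<close> is a factor of \<open>(z\<^sup>2)\<^sup>n \<noteq> 0\<close> and \<open>z\<close> is no eigenvalue.\<close>

lemma eigenvalue_mset_square_zero:
  fixes M :: "real ^ 'n ^ 'n::finite"
  assumes "M ** M = 0" and "z \<in># eigenvalue_mset M"
  shows "z = 0"
proof (rule ccontr)
  assume "z \<noteq> 0"
  define C where "C = (\<chi> i j. complex_of_real (M $ i $ j))"
  have "C ** C = (\<chi> i j. complex_of_real ((M ** M) $ i $ j))"
    by (simp add: C_def matrix_matrix_mult_def)
  then have CC: "(\<Sum>k\<in>UNIV. C $ i $ k * C $ k $ j) = 0" for i j
    using assms(1) by (simp add: vec_eq_iff matrix_matrix_mult_def[of C])
  have "(mat z - C) ** (mat z + C) = mat (z * z)"
    by (simp add: vec_eq_iff matrix_matrix_mult_def mat_def algebra_simps sum.distrib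
        sum_subtractf CC if_distrib[of "\<lambda>x. x * _"] if_distrib[of "\<lambda>x. _ * x"] sum.delta sum.delta' cong: if_cong)
  then have "det (mat z - C) * det (mat z + C) = det (mat (z * z) :: complex ^ 'n ^ 'n)"
    by (metis det_mul)
  moreover have "det (mat (z * z) :: complex ^ 'n ^ 'n) = (z * z) ^ CARD('n)"
    by (subst det_diagonal) (auto simp: mat_def)
  ultimately show False
    using eigenvalue_mset_root[OF assms(2)] \<open>z \<noteq> 0\<close> by (simp add: C_def)
qed

lemma elem_sym_zeros:
  assumes "\<And>z. z \<in># M \<Longrightarrow> z = 0" and "1 \<le> k"
  shows "elem_sym k M = 0"
  unfolding elem_sym_def
proof (rule sum.neutral, safe)
  fix S :: "('a \<times> nat) set"
  assume S: "S \<subseteq> {(z, i). i < count M z}" "k = card S"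
  then obtain p where p: "p \<in> S"
    using assms(2) by (cases "S = {}") auto
  then have "fst p \<in># M"
    using S(1) by (force simp: count_greater_zero_iff[symmetric] simp del: count_greater_zero_iff)
  moreover have "finite S"
    using S(2) assms(2) by (metis card.infinite not_one_le_zero)
  ultimately show "prod fst S = 0"
    using assms(1) p by (meson prod_zero)
qed

text \<open>A single nonzero component would leave just one, nonvanishing, term in
  \<open>\<Sum> \<epsilon>\<^sub>i \<alpha>\<^sub>i\<^sup>2\<close>.\<close>

lemma null_vector_two_components:
  fixes \<alpha> :: "real ^ 'n::finite"
  assumes "\<forall>i. \<epsilon> i = 1 \<or> \<epsilon> i = (-1::real)" and "\<alpha> \<noteq> 0"
    and "(\<Sum>i\<in>UNIV. \<epsilon> i * (\<alpha> $ i)\<^sup>2) = 0"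
  obtains i j where "i \<noteq> j" "\<alpha> $ i \<noteq> 0" "\<alpha> $ j \<noteq> 0"
proof -
  obtain i where i: "\<alpha> $ i \<noteq> 0"
    using assms(2) by (auto simp: vec_eq_iff)
  have "\<exists>j. j \<noteq> i \<and> \<alpha> $ j \<noteq> 0"
  proof (rule ccontr)
    assume "\<not> ?thesis"
    then have "(\<Sum>j\<in>UNIV. \<epsilon> j * (\<alpha> $ j)\<^sup>2) = (\<Sum>j\<in>UNIV. if j = i then \<epsilon> i * (\<alpha> $ i)\<^sup>2 else 0)"
      by (intro sum.cong) auto
    then have "\<epsilon> i * (\<alpha> $ i)\<^sup>2 = 0"
      using assms(3) by simp
    then show False
      using i assms(1)[rule_format, of i] by auto
  qed
  then show ?thesis
    using that i by metis
qed

lemma matrix_inv_eqI: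
  fixes B C :: "real ^ 'n ^ 'n::finite"
  assumes "B ** C = mat 1" "C ** B = mat 1"
  shows "matrix_inv B = C"
proof -
  have "matrix_inv B ** B = mat 1"
    unfolding matrix_inv_def by (rule someI2[of _ C]) (use assms in auto)
  then show ?thesis
    by (metis assms(1) matrix_mul_assoc matrix_mul_lid matrix_mul_rid)
qed

lemma matrix_inv_scaled_pseudo_euclidean:
  assumes "\<forall>i. \<epsilon> i = 1 \<or> \<epsilon> i = (-1::real)" and "r \<noteq> 0"
  shows "matrix_inv (r *\<^sub>R pseudo_euclidean \<epsilon> x) = (1 / r) *\<^sub>R pseudo_euclidean \<epsilon> x"
proof (rule matrix_inv_eqI)
  have "\<epsilon> i * \<epsilon> i = 1" for i
    using assms(1)[rule_format, of i] by auto
  then show "r *\<^sub>R pseudo_euclidean \<epsilon> x ** ((1 / r) *\<^sub>R pseudo_euclidean \<epsilon> x) = mat 1"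
    and "(1 / r) *\<^sub>R pseudo_euclidean \<epsilon> x ** (r *\<^sub>R pseudo_euclidean \<epsilon> x) = mat 1"
    using assms(2)
    by (auto simp: vec_eq_iff matrix_matrix_mult_def pseudo_euclidean_def mat_def
        if_distrib[of "\<lambda>x. x * _"] if_distrib[of "\<lambda>x. _ * x"] sum.delta sum.delta' cong: if_cong)
qed

section \<open>Derivatives of functions of one linear form\<close>

lemma smooth_on_real_twice_differentiable:
  assumes "smooth_on I (h :: real \<Rightarrow> real)"
  obtains h1 h2 where
    "\<And>t. t \<in> I \<Longrightarrow> (h has_real_derivative h1 t) (at t)"
    "\<And>t. t \<in> I \<Longrightarrow> (h1 has_real_derivative h2 t) (at t)"
proof
  have deriv: "(k has_real_derivative pderiv_dir 1 k t) (at t)"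
    if "k differentiable_on I" "t \<in> I" for k t
  proof -
    have "k differentiable at t"
      using that assms by (simp add: smooth_on_def differentiable_on_eq_differentiable_at)
    then have d: "(k has_derivative frechet_derivative k (at t)) (at t)"
      by (simp add: frechet_derivative_works)
    have "frechet_derivative k (at t) s = pderiv_dir 1 k t * s" for s
      using linear_scale[OF has_derivative_linear[OF d], of s 1] by (simp add: pderiv_dir_def)
    then show ?thesis
      using d by (simp add: has_field_derivative_def) (metis ext)
  qed
  have "fold pderiv_dir vs h differentiable_on I" if "set vs \<subseteq> {1}" for vs
    using assms that by (simp add: smooth_on_def)
  from this[of "[]"] this[of "[1]"]
  show "\<And>t. t \<in> I \<Longrightarrow> (h has_real_derivative pderiv_dir 1 h t) (at t)"
    and "\<And>t. t \<in> I \<Longrightarrow> (pderiv_dir 1 h has_real_derivative pderiv_dir 1 (pderiv_dir 1 h) t) (at t)"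
    by (auto intro: deriv)
qed

text \<open>The function \<open>F\<close> needs to be a function of \<open>\<alpha> \<bullet> y\<close> only on an open set: the conformal
  factor hidden in the Schouten tensor of a surface is known on the domain of the metric only.\<close>

lemma partial_ridge:
  fixes \<alpha> x :: "real ^ 'n::finite"
  assumes "open U" "x \<in> U" "\<And>y. y \<in> U \<Longrightarrow> F y = h (\<alpha> \<bullet> y)"
    and "(h has_real_derivative d) (at (\<alpha> \<bullet> x))"
  shows "partial i F x = d * \<alpha> $ i"
proof -
  have "((\<lambda>y. h (\<alpha> \<bullet> y)) has_derivative (\<lambda>v. d * (\<alpha> \<bullet> v))) (at x)"
    by (rule has_derivative_compose[where f = "\<lambda>y. \<alpha> \<bullet> y" and g = h])
       (use assms(4) in \<open>auto intro!: derivative_eq_intros simp: has_field_derivative_def\<close>)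
  then have "(F has_derivative (\<lambda>v. d * (\<alpha> \<bullet> v))) (at x)"
    by (rule has_derivative_transform_within_open[OF _ assms(1,2)]) (simp add: assms(3))
  then show ?thesis
    by (simp add: pderiv_dir_def frechet_derivative_at[symmetric] inner_axis)
qed

lemma partial_partial_ridge:
  fixes \<alpha> x :: "real ^ 'n::finite"
  assumes "open U" "x \<in> U" "\<And>y. y \<in> U \<Longrightarrow> F y = h (\<alpha> \<bullet> y)"
    and "\<And>y. y \<in> U \<Longrightarrow> (h has_real_derivative h1 (\<alpha> \<bullet> y)) (at (\<alpha> \<bullet> y))"
    and "(h1 has_real_derivative d) (at (\<alpha> \<bullet> x))"
  shows "partial i (partial j F) x = d * \<alpha> $ i * \<alpha> $ j"
proof -
  have "partial j F y = h1 (\<alpha> \<bullet> y) * \<alpha> $ j" if "y \<in> U" for y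
    using partial_ridge[OF assms(1) that assms(3) assms(4)[OF that]] .
  moreover have "((\<lambda>t. h1 t * \<alpha> $ j) has_real_derivative d * \<alpha> $ j) (at (\<alpha> \<bullet> x))"
    by (rule DERIV_cmult_right[OF assms(5)])
  ultimately show ?thesis
    using partial_ridge[OF assms(1,2), of "partial j F" "\<lambda>t. h1 t * \<alpha> $ j" \<alpha> "d * \<alpha> $ j"]
    by (simp add: mult_ac)
qed

lemma partial_const: "partial i (\<lambda>y. c) x = 0"
  by (simp add: pderiv_dir_def frechet_derivative_const)

lemma hessian_pseudo_euclidean: "hessian (pseudo_euclidean \<epsilon>) F x $ i $ j = partial i (partial j F) x"
  by (simp add: hessian_def christoffel_def pseudo_euclidean_def partial_const)

section \<open>Curvature of a metric conformal along a null direction\<close>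

text \<open>The Christoffel symbols of \<open>\<delta> / \<phi>\<^sup>2\<close> with \<open>\<phi> = \<phi>(\<alpha> \<bullet> x)\<close> are \<open>- \<phi>' / \<phi>\<close> times this constant
  array. Separating it from the function of \<open>\<alpha> \<bullet> x\<close> reduces all curvature computations to the
  contractions of the array below.\<close>

definition conformal_coeff :: "('n \<Rightarrow> real) \<Rightarrow> real ^ 'n \<Rightarrow> 'n::finite \<Rightarrow> 'n \<Rightarrow> 'n \<Rightarrow> real" where
  "conformal_coeff \<epsilon> \<alpha> m i j =
     (if m = j then \<alpha> $ i else 0) + (if m = i then \<alpha> $ j else 0)
       - (if i = j then \<epsilon> i * \<epsilon> m * \<alpha> $ m else 0)"

text \<open>The derivatives \<open>\<phi>1\<close> and \<open>\<phi>2\<close> are data of the locale so that they need to be known on \<open>I\<close> only.\<close>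

locale null_conformal_metric =
  fixes \<epsilon> :: "'n::finite \<Rightarrow> real" and \<alpha> :: "real ^ 'n"
    and I :: "real set" and \<phi> \<phi>1 \<phi>2 :: "real \<Rightarrow> real"
  assumes signs: "\<forall>i. \<epsilon> i = 1 \<or> \<epsilon> i = -1"
    and null: "(\<Sum>i\<in>UNIV. \<epsilon> i * (\<alpha> $ i)\<^sup>2) = 0"
    and open_I: "open I"
    and pos: "t \<in> I \<Longrightarrow> \<phi> t > 0"
    and deriv1: "t \<in> I \<Longrightarrow> (\<phi> has_real_derivative \<phi>1 t) (at t)"
    and deriv2: "t \<in> I \<Longrightarrow> (\<phi>1 has_real_derivative \<phi>2 t) (at t)"
begin

abbreviation U :: "(real ^ 'n) set" where
  "U \<equiv> (\<bullet>) \<alpha> -` I"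

abbreviation g :: "'n matfield" where
  "g \<equiv> conformal_metric \<epsilon> (\<lambda>x. \<phi> (\<alpha> \<bullet> x))"

abbreviation T :: "'n \<Rightarrow> 'n \<Rightarrow> 'n \<Rightarrow> real" where
  "T \<equiv> conformal_coeff \<epsilon> \<alpha>"

lemma open_U: "open U"
  by (intro open_vimage open_I continuous_intros)

lemma sign_square: "\<epsilon> i * \<epsilon> i = 1"
  using signs[rule_format, of i] by auto

lemma sign_square': "\<epsilon> i * (\<epsilon> i * c) = c"
  using sign_square[of i] by (simp flip: mult.assoc)

lemmas delta_simps = if_distrib[of "\<lambda>x. x * _"] if_distrib[of "\<lambda>x. _ * x"]
  sum.distrib sum_subtractf

text \<open>The third term of the array contributes a multiple of \<open>\<Sum> \<epsilon>\<^sub>m \<alpha>\<^sub>m\<^sup>2\<close>, hence nothing.\<close>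

lemma coeff_gradient: "(\<Sum>m\<in>UNIV. \<alpha> $ m * T m i j) = 2 * \<alpha> $ i * \<alpha> $ j"
proof -
  have "(\<Sum>m\<in>UNIV. \<alpha> $ m * T m i j) = (\<Sum>m\<in>UNIV. (if m = j then \<alpha> $ i * \<alpha> $ j else 0)
     + (if m = i then \<alpha> $ i * \<alpha> $ j else 0) - (if i = j then \<epsilon> i else 0) * (\<epsilon> m * (\<alpha> $ m)\<^sup>2))"
    by (rule sum.cong) (auto simp: conformal_coeff_def algebra_simps power2_eq_square)
  then show ?thesis
    by (simp add: sum.distrib sum_subtractf null flip: sum_distrib_left)
qed

lemma coeff_trace: "(\<Sum>m\<in>UNIV. T m i m) = real CARD('n) * \<alpha> $ i"
  using sign_square[of i]
  by (simp add: conformal_coeff_def sum.distrib sum_subtractf)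

lemma coeff_commute: "T m i j = T m j i"
  by (simp add: conformal_coeff_def)

text \<open>Summing over \<open>l\<close> first, each Kronecker delta of \<open>T m j l\<close> leaves one entry or one contraction
  already known; the part coming from the last delta sums to zero over \<open>m\<close>, since \<open>\<alpha>\<close> is null and
  its two other terms cancel.\<close>

lemma coeff_coeff:
  "(\<Sum>m\<in>UNIV. \<Sum>l\<in>UNIV. T m j l * T l i m) = (real CARD('n) + 2) * \<alpha> $ i * \<alpha> $ j"
proof -
  have "(\<Sum>l\<in>UNIV. T m j l * T l i m) =
      \<alpha> $ j * T m i m
      + (if m = j then 2 * \<alpha> $ i * \<alpha> $ m else 0)
      - \<epsilon> j * \<epsilon> m * \<alpha> $ m * T j i m" for m
  proof -
    have "(\<Sum>l\<in>UNIV. T m j l * T l i m) = (\<Sum>l\<in>UNIV. (if l = m then \<alpha> $ j * T m i m else 0)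
      + (if m = j then \<alpha> $ l * T l i m else 0) - (if l = j then \<epsilon> j * \<epsilon> m * \<alpha> $ m * T j i m else 0))"
      by (rule sum.cong) (auto simp: conformal_coeff_def[of _ _ m j] algebra_simps)
    then show ?thesis
      by (auto simp: sum.distrib sum_subtractf coeff_gradient)
  qed
  then have "(\<Sum>m\<in>UNIV. \<Sum>l\<in>UNIV. T m j l * T l i m) = \<alpha> $ j * (\<Sum>m\<in>UNIV. T m i m)
      + 2 * \<alpha> $ i * \<alpha> $ j - (\<Sum>m\<in>UNIV. \<epsilon> j * \<epsilon> m * \<alpha> $ m * T j i m)"
    by (simp add: sum.distrib sum_subtractf sum_distrib_left)
  moreover have "(\<Sum>m\<in>UNIV. \<epsilon> j * \<epsilon> m * \<alpha> $ m * T j i m) = 0"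
  proof -
    have "\<epsilon> j * \<epsilon> m * \<alpha> $ m * T j i m =  (if m = j then \<alpha> $ i * \<alpha> $ j else 0)
      + (if j = i then \<epsilon> j else 0) * (\<epsilon> m * (\<alpha> $ m)\<^sup>2)
       - (if m = i then \<alpha> $ i * \<alpha> $ j else 0)" for m
      by (auto simp: conformal_coeff_def algebra_simps power2_eq_square sign_square sign_square')
    then show ?thesis
      by (simp add: sum.distrib sum_subtractf null flip: sum_distrib_left)
  qed
  ultimately show ?thesis
    by (simp add: coeff_trace algebra_simps)
qed

lemma matrix_inv_g:
  assumes "x \<in> U"
  shows "matrix_inv (g x) $ i $ j = (if i = j then (\<phi> (\<alpha> \<bullet> x))\<^sup>2 * \<epsilon> i else 0)"
  using matrix_inv_scaled_pseudo_euclidean[OF signs, of "1 / (\<phi> (\<alpha> \<bullet> x))\<^sup>2"] pos[of "\<alpha> \<bullet> x"] assms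
  by (simp add: conformal_metric_def pseudo_euclidean_def)

lemma partial_g:
  assumes "x \<in> U"
  shows "partial i (\<lambda>y. g y $ j $ l) x
    = (if j = l then - 2 * \<epsilon> j * \<phi>1 (\<alpha> \<bullet> x) / (\<phi> (\<alpha> \<bullet> x)) ^ 3 * \<alpha> $ i else 0)"
proof (cases "j = l")
  case True
  have I: "\<alpha> \<bullet> x \<in> I" using assms by simp
  have "((\<lambda>t. \<epsilon> j / (\<phi> t)\<^sup>2) has_real_derivative - 2 * \<epsilon> j * \<phi>1 (\<alpha> \<bullet> x) / (\<phi> (\<alpha> \<bullet> x)) ^ 3) (at (\<alpha> \<bullet> x))"
    using pos[OF I]
    by (auto intro!: derivative_eq_intros deriv1[OF I] simp: field_simps power2_eq_square power3_eq_cube)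
  from partial_ridge[OF open_U assms _ this, of "\<lambda>y. g y $ j $ l"] True
  show ?thesis by (simp add: conformal_metric_def pseudo_euclidean_def)
next
  case False
  then show ?thesis
    by (simp add: conformal_metric_def pseudo_euclidean_def partial_const)
qed

lemma christoffel_g:
  assumes "x \<in> U"
  shows "christoffel g x m i j = - (\<phi>1 (\<alpha> \<bullet> x) / \<phi> (\<alpha> \<bullet> x)) * T m i j"
proof -
  have "\<phi> (\<alpha> \<bullet> x) > 0"
    using assms pos by simp
  then show ?thesis
    by (simp add: christoffel_def matrix_inv_g[OF assms] partial_g[OF assms] delta_simps cong: if_cong)
     (auto simp: conformal_coeff_def field_simps power2_eq_square power3_eq_cube sign_square sign_square')
qed

lemma hessian_g:
  assumes "x \<in> U"
    and "\<And>t. t \<in> I \<Longrightarrow> (h has_real_derivative h1 t) (at t)"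
    and "\<And>t. t \<in> I \<Longrightarrow> (h1 has_real_derivative h2 t) (at t)"
  shows "hessian g (\<lambda>x. h (\<alpha> \<bullet> x)) x $ i $ j =
    (h2 (\<alpha> \<bullet> x) + 2 * \<phi>1 (\<alpha> \<bullet> x) / \<phi> (\<alpha> \<bullet> x) * h1 (\<alpha> \<bullet> x)) * \<alpha> $ i * \<alpha> $ j"
proof -
  have I: "\<alpha> \<bullet> x \<in> I" using assms by simp
  have "partial i (partial j (\<lambda>x. h (\<alpha> \<bullet> x))) x = h2 (\<alpha> \<bullet> x) * \<alpha> $ i * \<alpha> $ j"
    by (rule partial_partial_ridge[OF open_U assms(1) refl assms(2) assms(3)[OF I]]) simp
  moreover have "partial m (\<lambda>x. h (\<alpha> \<bullet> x)) x = h1 (\<alpha> \<bullet> x) * \<alpha> $ m" for m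
    by (rule partial_ridge[OF open_U assms(1) refl assms(2)[OF I]])
  moreover have "(\<Sum>m\<in>UNIV. - (\<phi>1 (\<alpha> \<bullet> x) / \<phi> (\<alpha> \<bullet> x)) * T m i j * (h1 (\<alpha> \<bullet> x) * \<alpha> $ m))
    = - (\<phi>1 (\<alpha> \<bullet> x) / \<phi> (\<alpha> \<bullet> x)) * h1 (\<alpha> \<bullet> x) * (2 * \<alpha> $ i * \<alpha> $ j)"
    unfolding coeff_gradient[symmetric] sum_distrib_left by (rule sum.cong) auto
  ultimately show ?thesis
    by (simp add: hessian_def christoffel_g[OF assms(1)] algebra_simps)
qed

text \<open>With \<open>\<psi> = \<phi>' / \<phi>\<close>, the derivative terms of the Ricci tensor give \<open>(n - 2) \<psi>' \<alpha>\<^sub>i \<alpha>\<^sub>j\<close> and the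
  quadratic ones \<open>(2n - (n + 2)) \<psi>\<^sup>2 \<alpha>\<^sub>i \<alpha>\<^sub>j\<close>; and \<open>\<psi>' + \<psi>\<^sup>2 = \<phi>'' / \<phi>\<close>.\<close>

lemma ricci_g:
  assumes x: "x \<in> U"
  shows "ricci g x $ i $ j = (real CARD('n) - 2) * (\<phi>2 (\<alpha> \<bullet> x) / \<phi> (\<alpha> \<bullet> x)) * \<alpha> $ i * \<alpha> $ j"
proof -
  have I: "\<alpha> \<bullet> x \<in> I" using x by simp
  define \<psi> where "\<psi> = \<phi>1 (\<alpha> \<bullet> x) / \<phi> (\<alpha> \<bullet> x)"
  define \<psi>1 where "\<psi>1 = \<phi>2 (\<alpha> \<bullet> x) / \<phi> (\<alpha> \<bullet> x) - \<psi>\<^sup>2"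
  have "((\<lambda>t. - (\<phi>1 t / \<phi> t) * c) has_real_derivative - \<psi>1 * c) (at (\<alpha> \<bullet> x))" for c
    unfolding \<psi>1_def \<psi>_def using pos[OF I]
    by (auto intro!: derivative_eq_intros deriv1[OF I] deriv2[OF I] simp: field_simps power2_eq_square)
  from partial_ridge[OF open_U x _ this]
  have d: "partial l (\<lambda>y. christoffel g y m i j) x = - \<psi>1 * T m i j * \<alpha> $ l" for l m i j
    by (simp add: christoffel_g)
  have "(\<Sum>m\<in>UNIV. partial m (\<lambda>y. christoffel g y m i j) x - partial j (\<lambda>y. christoffel g y m i m) x)
    = - \<psi>1 * (\<Sum>m\<in>UNIV. \<alpha> $ m * T m i j) + \<psi>1 * \<alpha> $ j * (\<Sum>m\<in>UNIV. T m i m)"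
    unfolding d sum_distrib_left sum.distrib[symmetric] by (rule sum.cong) (auto simp: algebra_simps)
  also have "\<dots> = (real CARD('n) - 2) * \<psi>1 * \<alpha> $ i * \<alpha> $ j"
    by (simp add: coeff_gradient coeff_trace algebra_simps)
  finally have 1: "(\<Sum>m\<in>UNIV. partial m (\<lambda>y. christoffel g y m i j) x - partial j (\<lambda>y. christoffel g y m i m) x)
    = (real CARD('n) - 2) * \<psi>1 * \<alpha> $ i * \<alpha> $ j" .
  have "(\<Sum>m\<in>UNIV. \<Sum>l\<in>UNIV. T m m l * T l i j) = (\<Sum>l\<in>UNIV. (\<Sum>m\<in>UNIV. T m l m) * T l i j)"
    by (subst sum.swap) (simp add: sum_distrib_right coeff_commute[of _ _ "_::'n"])
  also have "\<dots> = real CARD('n) * (\<Sum>l\<in>UNIV. \<alpha> $ l * T l i j)"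
    by (simp add: coeff_trace sum_distrib_left mult.assoc)
  also have "\<dots> = 2 * real CARD('n) * \<alpha> $ i * \<alpha> $ j"
    by (simp add: coeff_gradient)
  finally have 2: "(\<Sum>m\<in>UNIV. \<Sum>l\<in>UNIV. T m m l * T l i j) = 2 * real CARD('n) * \<alpha> $ i * \<alpha> $ j" .
  have "(\<Sum>m\<in>UNIV. \<Sum>l\<in>UNIV. christoffel g x m m l * christoffel g x l i j
                        - christoffel g x m j l * christoffel g x l i m)
     = \<psi>\<^sup>2 * ((\<Sum>m\<in>UNIV. \<Sum>l\<in>UNIV. T m m l * T l i j) - (\<Sum>m\<in>UNIV. \<Sum>l\<in>UNIV. T m j l * T l i m))"
    unfolding christoffel_g[OF x] \<psi>_def[symmetric] sum_subtractf[symmetric] sum_distrib_left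
    by (intro sum.cong refl) (simp add: algebra_simps power2_eq_square)
  also have "\<dots> = (real CARD('n) - 2) * \<psi>\<^sup>2 * \<alpha> $ i * \<alpha> $ j"
    by (simp add: 2 coeff_coeff algebra_simps)
  finally show ?thesis
    unfolding ricci_def using 1 by (simp add: \<psi>1_def algebra_simps)
qed

text \<open>The trace of a multiple of \<open>\<alpha> \<otimes> \<alpha>\<close> is a multiple of \<open>\<Sum> \<epsilon>\<^sub>i \<alpha>\<^sub>i\<^sup>2\<close>.\<close>

lemma scal_g:
  assumes "x \<in> U"
  shows "scal g x = 0"
proof -
  have "scal g x = (\<Sum>i\<in>UNIV. (\<phi> (\<alpha> \<bullet> x))\<^sup>2 * (real CARD('n) - 2) * (\<phi>2 (\<alpha> \<bullet> x) / \<phi> (\<alpha> \<bullet> x)) * (\<epsilon> i * (\<alpha> $ i)\<^sup>2))"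
    unfolding scal_def matrix_inv_g[OF assms] ricci_g[OF assms]
    by (intro sum.cong refl)
       (simp add: if_distrib[of "\<lambda>x. x * _"] power2_eq_square
          del: times_divide_eq_left times_divide_eq_right cong: if_cong)
  then show ?thesis
    by (simp only: sum_distrib_left[symmetric] null mult_zero_right)
qed

lemma conformal_schouten_null_ridge:
  assumes "x \<in> U" and F: "\<And>y. y \<in> U \<Longrightarrow> F y = \<phi> (\<alpha> \<bullet> y)"
  shows "conformal_schouten \<epsilon> F x $ i $ j = \<phi>2 (\<alpha> \<bullet> x) / \<phi> (\<alpha> \<bullet> x) * \<alpha> $ i * \<alpha> $ j"
proof -
  have I: "\<alpha> \<bullet> x \<in> I" using assms by simp
  have "partial m F x = \<phi>1 (\<alpha> \<bullet> x) * \<alpha> $ m" for m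
    by (rule partial_ridge[OF open_U assms(1) F deriv1[OF I]])
  moreover have "partial i (partial j F) x = \<phi>2 (\<alpha> \<bullet> x) * \<alpha> $ i * \<alpha> $ j" for i j
    by (rule partial_partial_ridge[OF open_U assms(1) F deriv1 deriv2[OF I]]) auto
  moreover have "matrix_inv (pseudo_euclidean \<epsilon> x) = pseudo_euclidean \<epsilon> x"
    using matrix_inv_scaled_pseudo_euclidean[OF signs, of 1 x] by simp
  moreover have "(\<Sum>m\<in>UNIV. \<epsilon> m * (\<phi>1 (\<alpha> \<bullet> x) * \<alpha> $ m) * (\<phi>1 (\<alpha> \<bullet> x) * \<alpha> $ m))
     = (\<phi>1 (\<alpha> \<bullet> x))\<^sup>2 * (\<Sum>m\<in>UNIV. \<epsilon> m * (\<alpha> $ m)\<^sup>2)"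
    unfolding sum_distrib_left by (rule sum.cong) (auto simp: power2_eq_square)
  ultimately have "grad_norm_sq (pseudo_euclidean \<epsilon>) F x = 0"
    by (simp add: grad_norm_sq_def pseudo_euclidean_def delta_simps null cong: if_cong)
  then show ?thesis
    using \<open>partial i (partial j F) x = _\<close> F[OF assms(1)]
    by (simp add: conformal_schouten_def hessian_pseudo_euclidean)
qed

text \<open>In dimension two the Schouten tensor is given through some presentation \<open>\<delta>' / F\<^sup>2\<close> of the
  metric. Absolute values of the diagonal entries recover \<open>F\<close>, their signs recover \<open>\<epsilon>'\<close>.\<close>

lemma conformal_representation_unique:
  assumes "\<forall>i. \<epsilon>' i = 1 \<or> \<epsilon>' i = -1" "F x > 0" "x \<in> U" "g x = conformal_metric \<epsilon>' F x"
  shows "F x = \<phi> (\<alpha> \<bullet> x)" "\<epsilon>' = \<epsilon>"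
proof -
  have p: "\<phi> (\<alpha> \<bullet> x) > 0" using assms(3) pos by simp
  have e: "\<epsilon> i / (\<phi> (\<alpha> \<bullet> x))\<^sup>2 = \<epsilon>' i / (F x)\<^sup>2" for i
    using assms(4) by (simp add: conformal_metric_def pseudo_euclidean_def vec_eq_iff) (metis (full_types))
  have s: "\<epsilon> i = \<epsilon>' i \<and> (\<phi> (\<alpha> \<bullet> x))\<^sup>2 = (F x)\<^sup>2" for i
  proof -
    have "\<bar>\<epsilon> i / (\<phi> (\<alpha> \<bullet> x))\<^sup>2\<bar> = \<bar>\<epsilon>' i / (F x)\<^sup>2\<bar>" by (simp only: e)
    then have q: "(\<phi> (\<alpha> \<bullet> x))\<^sup>2 = (F x)\<^sup>2"
      using signs[rule_format, of i] assms(1)[rule_format, of i] by (auto simp: abs_mult)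
    with e[of i] p assms(2) show ?thesis by simp
  qed
  then show "\<epsilon>' = \<epsilon>" by auto
  show "F x = \<phi> (\<alpha> \<bullet> x)"
    using s p assms(2) by (auto simp: power2_eq_iff_nonneg)
qed

text \<open>The two cases of the definition agree here: the factor \<open>n - 2\<close> of the Ricci tensor cancels
  against the normalisation, and what is left is the value of the conformal formula.\<close>

lemma schouten_g:
  assumes "schouten_tensor_on U g A" and x: "x \<in> U"
  shows "A x $ i $ j = \<phi>2 (\<alpha> \<bullet> x) / \<phi> (\<alpha> \<bullet> x) * \<alpha> $ i * \<alpha> $ j"
proof (cases "CARD('n) = 2")
  case True
  then obtain \<epsilon>' F where *: "\<forall>i. \<epsilon>' i = 1 \<or> \<epsilon>' i = -1" "\<forall>x\<in>U. F x > 0"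
    "\<forall>x\<in>U. g x = conformal_metric \<epsilon>' F x" "\<forall>x\<in>U. A x = conformal_schouten \<epsilon>' F x"
    using assms(1) by (auto simp: schouten_tensor_on_def)
  then have "\<epsilon>' = \<epsilon>" and "\<And>y. y \<in> U \<Longrightarrow> F y = \<phi> (\<alpha> \<bullet> y)"
    using conformal_representation_unique[OF *(1), of F] x by blast+
  with *(4) x show ?thesis
    using conformal_schouten_null_ridge by simp
next
  case False
  then show ?thesis
    using assms by (simp add: schouten_tensor_on_def scal_g ricci_g)
qed

text \<open>The endomorphism \<open>g\<^sup>-\<^sup>1 A\<close> has entries proportional to \<open>\<epsilon>\<^sub>i \<alpha>\<^sub>i \<alpha>\<^sub>j\<close>, so its square has the factor
  \<open>\<Sum> \<epsilon>\<^sub>l \<alpha>\<^sub>l\<^sup>2 = 0\<close>.\<close>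

lemma sigma_g:
  assumes "schouten_tensor_on U g A" and x: "x \<in> U" and "1 \<le> k"
  shows "sigma k g A x = 0"
proof -
  define M where "M = matrix_inv (g x) ** A x"
  define r where "r = (\<phi> (\<alpha> \<bullet> x))\<^sup>2 * (\<phi>2 (\<alpha> \<bullet> x) / \<phi> (\<alpha> \<bullet> x))"
  have M: "M $ i $ j = r * \<epsilon> i * \<alpha> $ i * \<alpha> $ j" for i j
    by (simp add: M_def r_def matrix_matrix_mult_def matrix_inv_g[OF x] schouten_g[OF assms(1,2)]
        if_distrib[of "\<lambda>x. x * _"] del: times_divide_eq_left times_divide_eq_right cong: if_cong)
  have "(\<Sum>l\<in>UNIV. M $ i $ l * M $ l $ j)
      = r * r * \<epsilon> i * \<alpha> $ i * \<alpha> $ j * (\<Sum>l\<in>UNIV. \<epsilon> l * (\<alpha> $ l)\<^sup>2)" for i j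
    unfolding M sum_distrib_left by (rule sum.cong) (auto simp: power2_eq_square)
  then have "M ** M = 0"
    by (simp add: null matrix_matrix_mult_def vec_eq_iff)
  then show ?thesis
    unfolding sigma_def M_def[symmetric]
    using eigenvalue_mset_square_zero elem_sym_zeros \<open>1 \<le> k\<close> by blast
qed

end

section \<open>The differential equation of the potential function\<close>

lemma potential_as_integral:
  fixes \<phi> f :: "real \<Rightarrow> real"
  assumes "t\<^sub>0 \<in> einterval a b" "t \<in> einterval a b"
    and pos: "\<And>t. t \<in> einterval a b \<Longrightarrow> \<phi> t > 0"
    and \<phi>: "\<And>t. t \<in> einterval a b \<Longrightarrow> isCont \<phi> t"
    and f: "\<And>t. t \<in> einterval a b \<Longrightarrow> (f has_real_derivative c / (\<phi> t)\<^sup>2) (at t)"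
  shows "f t = (LBINT s=ereal t\<^sub>0..ereal t. c / (\<phi> s)\<^sup>2) + f t\<^sub>0"
proof -
  have sub: "s \<in> einterval a b" if "min t\<^sub>0 t \<le> s" "s \<le> max t\<^sub>0 t" for s
    using that assms(1,2)
    by (cases a; cases b) (auto simp: einterval_def min_def max_def split: if_splits)
  have "(LBINT s=ereal t\<^sub>0..ereal t. c / (\<phi> s)\<^sup>2) = f t - f t\<^sub>0"
  proof (rule interval_integral_FTC_finite)
    show "continuous_on {min t\<^sub>0 t..max t\<^sub>0 t} (\<lambda>s. c / (\<phi> s)\<^sup>2)"
      using \<phi> pos sub
      by (intro continuous_at_imp_continuous_on ballI continuous_intros) (fastforce simp: less_le)+
  next
    fix s assume "min t\<^sub>0 t \<le> s" "s \<le> max t\<^sub>0 t"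
    from f[OF sub[OF this]]
    show "(f has_vector_derivative c / (\<phi> s)\<^sup>2) (at s within {min t\<^sub>0 t..max t\<^sub>0 t})"
      by (simp add: has_real_derivative_iff_has_vector_derivative has_vector_derivative_at_within)
  qed
  then show ?thesis by simp
qed

text \<open>Multiplied by the integrating factor \<open>\<phi>\<^sup>2\<close>, the equation reads \<open>(\<phi>\<^sup>2 f')' = 0\<close>.\<close>

lemma weighted_derivative_constant:
  fixes \<phi> \<phi>1 f1 f2 :: "real \<Rightarrow> real"
  assumes pos: "\<And>t. t \<in> einterval a b \<Longrightarrow> \<phi> t > 0"
    and \<phi>: "\<And>t. t \<in> einterval a b \<Longrightarrow> (\<phi> has_real_derivative \<phi>1 t) (at t)"
    and f1: "\<And>t. t \<in> einterval a b \<Longrightarrow> (f1 has_real_derivative f2 t) (at t)"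
    and ode: "\<And>t. t \<in> einterval a b \<Longrightarrow> f2 t + 2 * \<phi>1 t / \<phi> t * f1 t = 0"
  obtains c where "\<And>t. t \<in> einterval a b \<Longrightarrow> f1 t = c / (\<phi> t)\<^sup>2"
proof -
  have "((\<lambda>t. (\<phi> t)\<^sup>2 * f1 t) has_real_derivative 0) (at t within einterval a b)"
    if t: "t \<in> einterval a b" for t
  proof -
    have "((\<lambda>t. (\<phi> t)\<^sup>2 * f1 t) has_real_derivative (\<phi> t)\<^sup>2 * (f2 t + 2 * \<phi>1 t / \<phi> t * f1 t)) (at t)"
      using pos[OF t]
      by (auto intro!: derivative_eq_intros \<phi>[OF t] f1[OF t] simp: field_simps power2_eq_square)
    then show ?thesis
      unfolding ode[OF t] by (simp add: has_field_derivative_at_within)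
  qed
  moreover have "convex (einterval a b)"
    by (cases a; cases b) (auto simp: convex_real_interval, simp_all add: einterval_def)
  ultimately obtain c where "\<And>t. t \<in> einterval a b \<Longrightarrow> (\<phi> t)\<^sup>2 * f1 t = c"
    using has_field_derivative_zero_constant[of "einterval a b"] by (metis (no_types, lifting))
  then show ?thesis
    using that pos by (metis less_irrefl nonzero_mult_div_cancel_left power_not_zero)
qed

theorem theorem1p3:
  fixes \<epsilon> :: "'n::finite \<Rightarrow> real" and \<alpha> :: "real ^ 'n" and \<xi> :: "real ^ 'n \<Rightarrow> real"
    and \<phi> f :: "real \<Rightarrow> real" and a b :: ereal and k :: nat and c\<^sub>s :: real
  assumes "CARD('n) \<ge> 2"
    and "\<forall>i. \<epsilon> i = 1 \<or> \<epsilon> i = -1"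
    and "\<alpha> \<noteq> 0"
    and "\<forall>x. \<xi> x = (\<Sum>i\<in>UNIV. \<alpha> $ i * x $ i)"
    and "a < b"
    and "smooth_on (einterval a b) \<phi>"
    and "smooth_on (einterval a b) f"
    and "\<forall>t\<in>einterval a b. \<phi> t > 0"
    and "gradient_k_yamabe_soliton k (\<xi> -` einterval a b)
           (conformal_metric \<epsilon> (\<phi> \<circ> \<xi>)) (f \<circ> \<xi>) c\<^sub>s"
    and "(\<Sum>i\<in>UNIV. \<epsilon> i * (\<alpha> $ i)\<^sup>2) = 0"
  shows "c\<^sub>s = 0 \<and>
    (\<exists>c. \<forall>t\<^sub>0\<in>einterval a b. \<exists>d. \<forall>t\<in>einterval a b.
       f t = (LBINT s=ereal t\<^sub>0..ereal t. c / (\<phi> s)\<^sup>2) + d)"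
proof -
  let ?I = "einterval a b"
  obtain \<phi>1 \<phi>2 where \<phi>: "\<And>t. t \<in> ?I \<Longrightarrow> (\<phi> has_real_derivative \<phi>1 t) (at t)"
    "\<And>t. t \<in> ?I \<Longrightarrow> (\<phi>1 has_real_derivative \<phi>2 t) (at t)"
    using smooth_on_real_twice_differentiable[OF assms(6)] by blast
  obtain f1 f2 where f: "\<And>t. t \<in> ?I \<Longrightarrow> (f has_real_derivative f1 t) (at t)"
    "\<And>t. t \<in> ?I \<Longrightarrow> (f1 has_real_derivative f2 t) (at t)"
    using smooth_on_real_twice_differentiable[OF assms(7)] by blast
  interpret null_conformal_metric \<epsilon> \<alpha> ?I \<phi> \<phi>1 \<phi>2
    using assms \<phi> by unfold_locales auto
  have \<xi>: "\<xi> = (\<bullet>) \<alpha>"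
    using assms(4) by (auto simp: inner_vec_def)
  obtain A where A: "schouten_tensor_on U g A" and k: "1 \<le> k"
    and eq: "\<And>x i j. x \<in> U \<Longrightarrow> complex_of_real (hessian g (\<lambda>x. f (\<alpha> \<bullet> x)) x $ i $ j) =
           2 * (of_nat CARD('n) - 1) * (sigma k g A x - complex_of_real c\<^sub>s)
             * complex_of_real (g x $ i $ j)"
    using assms(9) unfolding gradient_k_yamabe_soliton_def \<xi> comp_def by blast
  \<comment> \<open>The coefficient of \<open>\<alpha> \<otimes> \<alpha>\<close> in the Hessian of the potential function.\<close>
  define u where "u t = f2 t + 2 * \<phi>1 t / \<phi> t * f1 t" for t
  have eq': "u (\<alpha> \<bullet> x) * \<alpha> $ i * \<alpha> $ j = - 2 * (real CARD('n) - 1) * c\<^sub>s * g x $ i $ j"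
    if "x \<in> U" for x i j
  proof -
    have "complex_of_real (u (\<alpha> \<bullet> x) * \<alpha> $ i * \<alpha> $ j)
       = complex_of_real (- 2 * (real CARD('n) - 1) * c\<^sub>s * g x $ i $ j)"
      using eq[OF that, of i j] hessian_g[OF that, of f f1 f2 i j] f sigma_g[OF A that k]
      by (simp add: u_def algebra_simps)
    then show ?thesis by (simp only: of_real_eq_iff)
  qed
  obtain i j where ij: "i \<noteq> j" "\<alpha> $ i \<noteq> 0" "\<alpha> $ j \<noteq> 0"
    using null_vector_two_components[OF assms(2,3,10)] .
  \<comment> \<open>The coefficient depends on \<open>\<alpha> \<bullet> x\<close> alone, so its vanishing on all of the interval needs every
    value of the interval to be attained by \<open>\<alpha> \<bullet> x\<close>.\<close>
  have surj: "\<exists>x\<in>U. \<alpha> \<bullet> x = t" if "t \<in> ?I" for t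
  proof -
    have "\<alpha> \<bullet> axis i (t / \<alpha> $ i) = t"
      using ij(2) by (simp add: inner_axis)
    with that show ?thesis by (metis vimageI)
  qed
  have u: "u t = 0" if t: "t \<in> ?I" for t
  proof -
    obtain x where x: "x \<in> U" "\<alpha> \<bullet> x = t" using surj[OF t] by blast
    have "g x $ i $ j = 0"
      using ij(1) by (simp add: conformal_metric_def pseudo_euclidean_def)
    then show ?thesis
      using eq'[OF x(1), of i j] x(2) ij by simp
  qed
  obtain t where t: "t \<in> ?I"
    using einterval_nonempty[OF assms(5)] by blast
  have "c\<^sub>s = 0"
  proof -
    obtain x where x: "x \<in> U" "\<alpha> \<bullet> x = t" using surj[OF t] by blast
    have "g x $ i $ i \<noteq> 0"
      using pos[OF t] x(2) signs[rule_format, of i] by (auto simp: conformal_metric_def pseudo_euclidean_def)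
    moreover have "real CARD('n) - 1 \<noteq> 0"
      using assms(1) by linarith
    ultimately show ?thesis
      using eq'[OF x(1), of i i] u[OF t] x(2) by simp
  qed
  moreover obtain c where c: "\<And>t. t \<in> ?I \<Longrightarrow> f1 t = c / (\<phi> t)\<^sup>2"
    using weighted_derivative_constant[of a b \<phi> \<phi>1 f1 f2] pos \<phi>(1) f(2) u unfolding u_def by metis
  then have "f t = (LBINT s=ereal t\<^sub>0..ereal t. c / (\<phi> s)\<^sup>2) + f t\<^sub>0" if "t\<^sub>0 \<in> ?I" "t \<in> ?I" for t\<^sub>0 t
    using that f(1) by (intro potential_as_integral[OF that pos]) (auto intro: DERIV_isCont \<phi>(1))
  ultimately show ?thesis by blast
qed

end
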